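(* Let $k\ge 1$ be odd, let $N\ge k$, and let $h_k^{(N)}=\sum_{1\le i_1<\dots<i_k\le N}\sigma_z^{i_1}\cdots\sigma_z^{i_k}$ on $(\mathbb{C}^2)^{\otimes N}$. For a unit vector $|\psi\rangle$ let $F(\psi)=4\left(\langle\psi|(h_k^{(N)})^2|\psi\rangle-\langle\psi|h_k^{(N)}|\psi\rangle^2\right)$. The maximum eigenvalue of $h_k^{(N)}$ is $\binom{N}{k}$, with eigenvector $|0\rangle^{\otimes N}$, and its minimum eigenvalue is $-\binom{N}{k}$, with eigenvector $|1\rangle^{\otimes N}$. Consequently $\max_{|\psi\rangle}F(\psi)=4\binom{N}{k}^2$, this maximum is attained by $\left(|0\rangle^{\otimes N}+|1\rangle^{\otimes N}\right)/\sqrt{2}$, and the optimal probes, i.e. the unit vectors attaining the maximum, necessarily possess genuine multipartite entanglement.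
   Context: $\sigma_z^{i}$ denotes $\sigma_z=\mathrm{diag}(1,-1)$ acting on the $i$-th qubit; $|0\rangle,|1\rangle$ are the eigenvectors of $\sigma_z$ with eigenvalues $+1,-1$. $F(\psi)$ is the quantum Fisher information for estimating $J$ in the encoding Hamiltonian $Jh_k^{(N)}$ with pure probe $|\psi\rangle$. An $N$-partite pure state is genuinely multipartite entangled iff for every bipartition of the parties into two nonempty sets the reduced density matrices are mixed (not pure).
   Formalization: The claim that all optimal probes are genuinely multipartite entangled is stated only for k<N or N=1; for k=N≥3 it is false: (|0⟩+|1⟩)/√2⊗|0⟩⊗…⊗|0⟩ is an optimal product state. Everything else, and the entanglement of (|0⟩^N+|1⟩^N)/√2, is stated for all N≥k. *)

theory Defs
  imports "HOL-Analysis.Analysis"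
begin

section \<open>Qubit registers\<close>

text \<open>
  The qubits of a register are the elements of a finite linearly ordered type \<open>'q\<close>, so that
  \<open>N = CARD('q)\<close>. The space \<open>(\<complex>\<^sup>2)\<^sup>\<otimes>\<^sup>N\<close> is \<open>\<complex>\<close> to the power of the set of
  bit strings \<open>'q \<Rightarrow> bool\<close> labelling the computational basis. The bit \<open>False\<close> stands for
  \<open>|0\<rangle>\<close> and \<open>True\<close> for \<open>|1\<rangle>\<close>; the norm of the library is the Hilbert space norm.
\<close>

type_synonym qubit = "complex ^ bool"
type_synonym qubit_op = "complex ^ bool ^ bool"
type_synonym 'q state = "complex ^ ('q \<Rightarrow> bool)"
type_synonym 'q state_op = "complex ^ ('q \<Rightarrow> bool) ^ ('q \<Rightarrow> bool)"

definition ket0 :: qubit where "ket0 = axis False 1"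
definition ket1 :: qubit where "ket1 = axis True 1"

definition sigma_z :: qubit_op where
  "sigma_z = (\<chi> a b. if a = b then (if a then -1 else 1) else 0)"

definition tensor_state :: "('q::finite \<Rightarrow> qubit) \<Rightarrow> 'q state" where
  "tensor_state v = (\<chi> x. \<Prod>i\<in>UNIV. v i $ x i)"

definition tensor_op :: "('q::finite \<Rightarrow> qubit_op) \<Rightarrow> 'q state_op" where
  "tensor_op A = (\<chi> x y. \<Prod>i\<in>UNIV. A i $ x i $ y i)"

definition sigma_z_at :: "'q::finite \<Rightarrow> 'q state_op" where
  "sigma_z_at i = tensor_op (\<lambda>j. if j = i then sigma_z else mat 1)"

text \<open>The strictly increasing lists of length \<open>k\<close> are the index tuples \<open>i\<^sub>1 < \<dots> < i\<^sub>k\<close>.\<close>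

definition h_op :: "nat \<Rightarrow> 'q::{finite, linorder} state_op" where
  "h_op k = (\<Sum>js\<in>{js. sorted_wrt (<) js \<and> length js = k}.
               foldr (\<lambda>i M. sigma_z_at i ** M) js (mat 1))"

text \<open>
  Pitfall: \<open>h_op k\<close> has simple extreme eigenvalues for odd \<open>k < N\<close>, but for \<open>k = N\<close> it is
  \<open>\<sigma>\<^sub>z \<otimes> \<dots> \<otimes> \<sigma>\<^sub>z\<close>, whose eigenvalues \<open>\<plusminus>1\<close> are degenerate when \<open>N \<ge> 2\<close>. The product vector
  \<open>(|0\<rangle> + |1\<rangle>)/\<surd>2 \<otimes> |0\<rangle> \<otimes> \<dots> \<otimes> |0\<rangle>\<close> then also maximizes the Fisher information, so that not
  every maximizer is entangled.
\<close>

definition ghz :: "'q::finite state" where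
  "ghz = (1 / sqrt 2) *\<^sub>R (tensor_state (\<lambda>_. ket0) + tensor_state (\<lambda>_. ket1))"


section \<open>Eigenvalues and quantum Fisher information\<close>

definition eigenvector :: "complex ^ 'n ^ 'n \<Rightarrow> complex ^ 'n \<Rightarrow> complex \<Rightarrow> bool" where
  "eigenvector A v \<mu> \<longleftrightarrow> v \<noteq> 0 \<and> A *v v = \<mu> *s v"

definition eigenvalue :: "complex ^ 'n ^ 'n \<Rightarrow> complex \<Rightarrow> bool" where
  "eigenvalue A \<mu> \<longleftrightarrow> (\<exists>v. eigenvector A v \<mu>)"

definition braket :: "complex ^ 'n \<Rightarrow> complex ^ 'n \<Rightarrow> complex" where
  "braket u v = (\<Sum>x\<in>UNIV. cnj (u $ x) * v $ x)"

text \<open>For Hermitian \<open>H\<close>, the only case of interest, the argument of \<open>Re\<close> is a real number.\<close>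

definition qfi :: "complex ^ 'n ^ 'n \<Rightarrow> complex ^ 'n \<Rightarrow> real" where
  "qfi H \<psi> = Re (4 * (braket \<psi> ((H ** H) *v \<psi>) - (braket \<psi> (H *v \<psi>))\<^sup>2))"


section \<open>Genuine multipartite entanglement\<close>

text \<open>
  For a set \<open>S\<close> of parties, the basis of their joint space is labelled by the extensional functions
  \<open>S \<rightarrow>\<^sub>E UNIV\<close>, and operators on that space are given by their matrix entries at such labels.
  If \<open>x\<close> labels \<open>S\<close> and \<open>z\<close> labels its complement, then \<open>override_on z x S\<close> is the
  joint label of the whole register.
\<close>

definition labels :: "'q set \<Rightarrow> ('q \<Rightarrow> bool) set" where
  "labels S = (S \<rightarrow>\<^sub>E UNIV)"

definition density_op :: "'q::finite state \<Rightarrow> 'q state_op" where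
  "density_op \<psi> = (\<chi> x y. \<psi> $ x * cnj (\<psi> $ y))"

definition reduced_density ::
    "'q::finite set \<Rightarrow> 'q state_op \<Rightarrow> ('q \<Rightarrow> bool) \<Rightarrow> ('q \<Rightarrow> bool) \<Rightarrow> complex" where
  "reduced_density S \<rho> x y =
     (\<Sum>z\<in>labels (- S). \<rho> $ override_on z x S $ override_on z y S)"

definition pure_density ::
    "'q set \<Rightarrow> (('q \<Rightarrow> bool) \<Rightarrow> ('q \<Rightarrow> bool) \<Rightarrow> complex) \<Rightarrow> bool" where
  "pure_density S \<rho> \<longleftrightarrow>
     (\<exists>\<phi>. (\<Sum>x\<in>labels S. (cmod (\<phi> x))\<^sup>2) = 1 \<and>
          (\<forall>x\<in>labels S. \<forall>y\<in>labels S. \<rho> x y = \<phi> x * cnj (\<phi> y)))"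

text \<open>
  The reduced states of both sides of a bipartition are covered, since \<open>S\<close> ranges over all
  nonempty proper subsets. With a single party there is no bipartition.
\<close>

definition genuinely_multipartite_entangled :: "'q::finite state \<Rightarrow> bool" where
  "genuinely_multipartite_entangled \<psi> \<longleftrightarrow>
     (\<forall>S. S \<noteq> {} \<and> S \<noteq> UNIV \<longrightarrow> \<not> pure_density S (reduced_density S (density_op \<psi>)))"

end

(*
  The operator h is diagonal in the computational basis; its entry at a bit string x is the
  sum of the signs prod_{i in A} s(x_i) over all k-subsets A, hence of modulus at most (N choose k),
  and it equals +(N choose k), -(N choose k) at the two constant strings (k is odd). On a unit vector
  the Fisher information is four times the variance of this entry under |psi|^2, so it is at most
  4 (N choose k)^2, with equality iff |psi|^2 lives on entries of maximal modulus and has mean zero.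
  If k < N, exchanging one element of a k-subset shows that the modulus is maximal at constant strings
  only, so optimal probes are (up to phases) GHZ states. Their reduced matrix on a proper nonempty S has
  nonzero diagonal entries at the two constant labels and a zero between them, so it is not of rank one.
*)

theory Submission
  imports Defs
begin

section \<open>Diagonal operators\<close>

text \<open>Real entries cover all products of \<open>sigma_z_at\<close> and keep every eigenvalue
  and expectation value real.\<close>

definition diag_op :: "('n::finite \<Rightarrow> real) \<Rightarrow> complex ^ 'n ^ 'n" where
  "diag_op d = (\<chi> x y. if x = y then complex_of_real (d x) else 0)"

lemma mat_1_eq_diag_op: "mat 1 = diag_op (\<lambda>_. 1)"
  by (simp add: mat_def diag_op_def vec_eq_iff)

lemma diag_op_mult: "diag_op a ** diag_op b = diag_op (\<lambda>x. a x * b x)"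
proof -
  have "(\<Sum>z\<in>UNIV. (if x = z then complex_of_real (a x) else 0) *
            (if z = y then complex_of_real (b z) else 0))
      = (\<Sum>z\<in>UNIV. if x = z then (if x = y then complex_of_real (a x * b x) else 0) else 0)" for x y
    by (rule sum.cong) auto
  then show ?thesis
    by (simp add: diag_op_def matrix_matrix_mult_def vec_eq_iff)
qed

lemma diag_op_vector_mult: "(diag_op d *v v) $ x = complex_of_real (d x) * v $ x"
proof -
  have "(diag_op d *v v) $ x = (\<Sum>y\<in>UNIV. if x = y then complex_of_real (d x) * v $ x else 0)"
    unfolding diag_op_def matrix_vector_mult_def vec_lambda_beta by (rule sum.cong) auto
  then show ?thesis by simp
qed

lemma sum_diag_op: "(\<Sum>i\<in>I. diag_op (d i)) = diag_op (\<lambda>x. \<Sum>i\<in>I. d i x)"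
  by (auto simp: diag_op_def vec_eq_iff)

lemma eigenvalue_diag_op:
  assumes "eigenvalue (diag_op d) \<mu>"
  obtains x where "\<mu> = complex_of_real (d x)"
proof -
  obtain v where v: "v \<noteq> 0" "diag_op d *v v = \<mu> *s v"
    using assms by (auto simp: eigenvalue_def eigenvector_def)
  then obtain x where "v $ x \<noteq> 0" by (auto simp: vec_eq_iff)
  moreover have "complex_of_real (d x) * v $ x = \<mu> * v $ x"
    using arg_cong[OF v(2), of "\<lambda>w. w $ x"] by (simp add: diag_op_vector_mult)
  ultimately show ?thesis using that by auto
qed

lemma eigenvector_diag_op_axis: "eigenvector (diag_op d) (axis x 1) (complex_of_real (d x))"
  by (auto simp: eigenvector_def vec_eq_iff diag_op_vector_mult axis_def)

text \<open>Squaring a diagonal operator squares its entries, so both brackets become moments of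
  \<open>d\<close> with weights \<open>(cmod (\<psi> $ x))\<^sup>2\<close>.\<close>

lemma qfi_diag_op:
  "qfi (diag_op d) \<psi> = 4 * ((\<Sum>x\<in>UNIV. (cmod (\<psi> $ x))\<^sup>2 * (d x)\<^sup>2)
      - (\<Sum>x\<in>UNIV. (cmod (\<psi> $ x))\<^sup>2 * d x)\<^sup>2)"
proof -
  have "braket \<psi> (diag_op e *v \<psi>) = complex_of_real (\<Sum>x\<in>UNIV. (cmod (\<psi> $ x))\<^sup>2 * e x)" for e
    unfolding braket_def of_real_sum
  proof (rule sum.cong)
    fix x
    show "cnj (\<psi> $ x) * (diag_op e *v \<psi>) $ x = complex_of_real ((cmod (\<psi> $ x))\<^sup>2 * e x)"
      unfolding of_real_mult complex_norm_square by (simp add: diag_op_vector_mult)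
  qed simp
  then have "qfi (diag_op d) \<psi> = Re (complex_of_real (4 * ((\<Sum>x\<in>UNIV. (cmod (\<psi> $ x))\<^sup>2 * (d x)\<^sup>2)
      - (\<Sum>x\<in>UNIV. (cmod (\<psi> $ x))\<^sup>2 * d x)\<^sup>2)))"
    unfolding qfi_def diag_op_mult by (simp add: power2_eq_square)
  then show ?thesis by simp
qed

lemma norm_1_iff_sum_cmod_squares:
  fixes \<psi> :: "complex ^ 'n"
  shows "norm \<psi> = 1 \<longleftrightarrow> (\<Sum>x\<in>UNIV. (cmod (\<psi> $ x))\<^sup>2) = 1"
  by (simp add: norm_vec_def L2_set_def)

text \<open>The deficit \<open>C\<^sup>2 - qfi / 4\<close> splits into the weighted gap
  \<open>r\<close> of the squared entries below \<open>C\<^sup>2\<close> and the squared mean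
  \<open>m\<^sup>2\<close>. Both are nonnegative, so equality forces both to vanish.\<close>

lemma
  fixes \<psi> :: "complex ^ 'n"
  assumes "norm \<psi> = 1" and d: "\<And>x. \<bar>d x\<bar> \<le> C"
  shows qfi_diag_op_le: "qfi (diag_op d) \<psi> \<le> 4 * C\<^sup>2"
    and qfi_diag_op_max_support:
      "qfi (diag_op d) \<psi> = 4 * C\<^sup>2 \<Longrightarrow> \<psi> $ x \<noteq> 0 \<Longrightarrow> \<bar>d x\<bar> = C"
    and qfi_diag_op_max_mean:
      "qfi (diag_op d) \<psi> = 4 * C\<^sup>2 \<Longrightarrow> (\<Sum>x\<in>UNIV. (cmod (\<psi> $ x))\<^sup>2 * d x) = 0"
proof -
  let ?p = "\<lambda>x. (cmod (\<psi> $ x))\<^sup>2"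
  define m where "m = (\<Sum>x\<in>UNIV. ?p x * d x)"
  define r where "r = (\<Sum>x\<in>UNIV. ?p x * (C\<^sup>2 - (d x)\<^sup>2))"
  \<comment> \<open>The bound at an arbitrary index, here \<open>undefined\<close>, already makes
    \<open>C\<close> nonnegative.\<close>
  have C: "C \<ge> 0" using d[of undefined] by linarith
  have nn: "?p x * (C\<^sup>2 - (d x)\<^sup>2) \<ge> 0" for x
    using abs_le_square_iff[of "d x" C] d[of x] C by simp
  have r: "r \<ge> 0" unfolding r_def by (rule sum_nonneg) (rule nn)
  have p: "(\<Sum>x\<in>UNIV. ?p x) = 1"
    using assms(1) by (simp add: norm_1_iff_sum_cmod_squares)
  have "r = (\<Sum>x\<in>UNIV. ?p x) * C\<^sup>2 - (\<Sum>x\<in>UNIV. ?p x * (d x)\<^sup>2)"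
    by (simp add: r_def right_diff_distrib sum_subtractf sum_distrib_right)
  then have eq: "qfi (diag_op d) \<psi> = 4 * (C\<^sup>2 - r - m\<^sup>2)"
    by (simp add: qfi_diag_op p m_def)
  have "C\<^sup>2 - r - m\<^sup>2 \<le> C\<^sup>2" using r zero_le_power2[of m] by linarith
  then show "qfi (diag_op d) \<psi> \<le> 4 * C\<^sup>2" unfolding eq by (rule mult_left_mono) simp
  {
    assume max: "qfi (diag_op d) \<psi> = 4 * C\<^sup>2"
    then have "r + m\<^sup>2 = 0" using eq by simp
    then have zero: "r = 0 \<and> m\<^sup>2 = 0" using r by (simp add: add_nonneg_eq_0_iff)
    then show "(\<Sum>x\<in>UNIV. ?p x * d x) = 0" by (simp add: m_def)
    assume "\<psi> $ x \<noteq> 0"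
    moreover have "?p x * (C\<^sup>2 - (d x)\<^sup>2) = 0"
      using conjunct1[OF zero] nn unfolding r_def by (subst (asm) sum_nonneg_eq_0_iff) auto
    ultimately have "(d x)\<^sup>2 = C\<^sup>2" by simp
    then show "\<bar>d x\<bar> = C" using C by (simp add: power2_eq_iff) linarith
  }
qed

section \<open>The spectrum of the Hamiltonian\<close>

definition spin :: "bool \<Rightarrow> real" where
  "spin b = (if b then -1 else 1)"

text \<open>The elementary symmetric polynomial of degree \<open>k\<close> in the signs
  \<open>spin (x i)\<close>.\<close>

definition h_entry :: "nat \<Rightarrow> ('q::finite \<Rightarrow> bool) \<Rightarrow> real" where
  "h_entry k x = (\<Sum>A | card A = k. \<Prod>i\<in>A. spin (x i))"

lemma spin_prod: "(\<Prod>i\<in>A. spin (x i)) = 1 \<or> (\<Prod>i\<in>A. spin (x i)) = -1"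
  by (induction A rule: infinite_finite_induct) (auto simp: spin_def)

text \<open>Every tensor factor is diagonal, so one differing bit kills the product; on equal labels
  only qubit \<open>i\<close> contributes a factor that can differ from 1.\<close>

lemma sigma_z_at_eq_diag_op: "sigma_z_at i = diag_op (\<lambda>x. spin (x i))"
proof -
  have "(\<Prod>j\<in>UNIV. (if j = i then sigma_z else mat 1) $ x j $ y j)
      = (if x = y then complex_of_real (spin (x i)) else 0)" for x y :: "'a \<Rightarrow> bool"
  proof (cases "x = y")
    case True
    have "(\<Prod>j\<in>UNIV. (if j = i then sigma_z else mat 1) $ x j $ y j)
        = (\<Prod>j\<in>UNIV. if j = i then complex_of_real (spin (x i)) else 1)"
      by (rule prod.cong) (auto simp: True sigma_z_def mat_def spin_def)
    then show ?thesis by (simp add: True)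
  next
    case False
    then obtain j where "x j \<noteq> y j" by auto
    then have "(if j = i then sigma_z else mat 1) $ x j $ y j = (0::complex)"
      by (simp add: sigma_z_def mat_def)
    then have "(\<Prod>j\<in>UNIV. (if j = i then sigma_z else mat 1) $ x j $ y j) = (0::complex)"
      by (intro prod_zero bexI[of _ j]) simp_all
    then show ?thesis using False by simp
  qed
  then show ?thesis
    by (simp add: sigma_z_at_def tensor_op_def diag_op_def)
qed

text \<open>Strictly increasing lists of length \<open>k\<close> correspond to
  \<open>k\<close>-subsets, with inverse \<open>sorted_list_of_set\<close>; this turns the sum over
  index tuples into \<open>h_entry\<close>.\<close>

lemma h_op_eq_diag_op: "h_op k = diag_op (h_entry k)"
proof -
  let ?L = "{js::'a list. sorted_wrt (<) js \<and> length js = k}"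
  have fold: "foldr (\<lambda>i M. sigma_z_at i ** M) js (mat 1)
      = diag_op (\<lambda>x. \<Prod>i\<in>set js. spin (x i))" if "sorted_wrt (<) js" for js :: "'a list"
    using that
    by (induction js) (auto simp: mat_1_eq_diag_op sigma_z_at_eq_diag_op diag_op_mult)
  have "bij_betw set ?L {A. card A = k}"
  proof (rule bij_betwI[where g = sorted_list_of_set])
    show "set \<in> ?L \<rightarrow> {A. card A = k}"
      by (auto simp: strict_sorted_iff distinct_card)
    show "sorted_list_of_set \<in> {A. card A = k} \<rightarrow> ?L" by auto
  qed (auto simp: strict_sorted_iff sorted_list_of_set.idem_if_sorted_distinct)
  then have "(\<Sum>js\<in>?L. \<Prod>i\<in>set js. spin (x i)) = h_entry k x" for x
    unfolding h_entry_def by (rule sum.reindex_bij_betw)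
  moreover have "h_op k = (\<Sum>js\<in>?L. diag_op (\<lambda>x. \<Prod>i\<in>set js. spin (x i)))"
    unfolding h_op_def by (rule sum.cong) (auto simp: fold)
  ultimately show ?thesis by (simp add: sum_diag_op)
qed

lemma card_subsets_UNIV: "card {A :: 'q::finite set. card A = k} = CARD('q) choose k"
  using n_subsets[of "UNIV :: 'q set" k] by simp

text \<open>For odd \<open>k\<close> the power keeps the sign, so the two constant strings give the
  extreme entries of opposite sign.\<close>

lemma h_entry_const: "h_entry k (\<lambda>_::'q::finite. b) = spin b ^ k * real (CARD('q) choose k)"
proof -
  have "h_entry k (\<lambda>_::'q. b) = (\<Sum>A | card (A :: 'q set) = k. spin b ^ k)"
    unfolding h_entry_def by (rule sum.cong) auto
  then show ?thesis by (simp add: card_subsets_UNIV)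
qed

lemma h_entry_le: "\<bar>h_entry k (x :: 'q::finite \<Rightarrow> bool)\<bar> \<le> real (CARD('q) choose k)"
proof -
  have "\<bar>h_entry k x\<bar> \<le> (\<Sum>A | card (A :: 'q set) = k. \<bar>\<Prod>i\<in>A. spin (x i)\<bar>)"
    unfolding h_entry_def by (rule sum_abs)
  also have "\<dots> = (\<Sum>A | card (A :: 'q set) = k. 1)"
  proof (rule sum.cong)
    show "\<bar>\<Prod>i\<in>A. spin (x i)\<bar> = 1" for A using spin_prod[of x A] by auto
  qed simp
  finally show ?thesis by (simp add: card_subsets_UNIV)
qed

text \<open>Maximal modulus leaves no cancellation: all products over \<open>k\<close>-subsets share
  one sign \<open>s\<close>. Comparing \<open>insert a B\<close> with \<open>insert b B\<close> then
  equates the two bits.\<close>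

lemma h_entry_extremal_imp_const:
  fixes x :: "'q::finite \<Rightarrow> bool"
  assumes "1 \<le> k" "k < CARD('q)" and max: "\<bar>h_entry k x\<bar> = real (CARD('q) choose k)"
  shows "x a = x b"
proof (rule ccontr)
  assume ab: "x a \<noteq> x b"
  let ?P = "\<lambda>A. \<Prod>i\<in>A. spin (x i)"
  obtain s where s: "s = 1 \<or> s = -1" "s * h_entry k x = real (CARD('q) choose k)"
    using max by (cases "h_entry k x \<ge> 0") (auto intro: that[of 1] that[of "-1"])
  have nn: "1 - s * ?P A \<ge> 0" for A
    using s(1) spin_prod[of x A] by auto
  \<comment> \<open>There are \<open>CARD('q) choose k\<close> subsets, so these nonnegative
    deficits sum to zero and each of them vanishes.\<close>
  have "(\<Sum>A | card A = k. 1 - s * ?P A) = 0"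
    using s(2) by (simp add: sum_subtractf card_subsets_UNIV h_entry_def sum_distrib_left)
  then have eq: "s * ?P A = 1" if "card A = k" for A
    using nn that by (subst (asm) sum_nonneg_eq_0_iff) auto
  have "a \<noteq> b" using ab by auto
  then have "card {a, b} = 2" by simp
  then have "card (- {a, b}) = CARD('q) - 2" by (simp add: card_Diff_subset Compl_eq_Diff_UNIV)
  \<comment> \<open>Here \<open>k < CARD('q)\<close> matters: \<open>k - 1\<close> elements must fit
    outside \<open>a\<close> and \<open>b\<close>.\<close>
  with assms have "k - 1 \<le> card (- {a, b})" by linarith
  then obtain B where B: "B \<subseteq> - {a, b}" "card B = k - 1"
    by (elim obtain_subset_with_card_n)
  have "s * (spin (x c) * ?P B) = 1" if "c \<in> {a, b}" for c
  proof -
    have "c \<notin> B" using B(1) that by auto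
    then show ?thesis using eq[of "insert c B"] B(2) assms(1) by simp
  qed
  from this[of a] this[of b] ab show False by (auto simp: spin_def)
qed

section \<open>GHZ-like states\<close>

lemma tensor_state_axis:
  fixes x :: "'q::finite \<Rightarrow> bool"
  shows "tensor_state (\<lambda>i. axis (x i) 1) = axis x 1"
proof -
  have "(\<Prod>i\<in>UNIV. axis (x i) (1::complex) $ y i) = axis x 1 $ y" for y
  proof (cases "y = x")
    case False
    then obtain j where "y j \<noteq> x j" by auto
    then show ?thesis using False by (auto simp: axis_def intro!: prod_zero)
  qed (simp add: axis_def)
  then show ?thesis by (simp add: tensor_state_def vec_eq_iff)
qed

lemma tensor_state_ket0: "tensor_state (\<lambda>_::'q::finite. ket0) = axis (\<lambda>_. False) 1"
  unfolding ket0_def by (rule tensor_state_axis)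

lemma tensor_state_ket1: "tensor_state (\<lambda>_::'q::finite. ket1) = axis (\<lambda>_. True) 1"
  unfolding ket1_def by (rule tensor_state_axis)

lemma ghz_nth:
  "(ghz :: 'q::finite state) $ x = (if \<exists>b. x = (\<lambda>_. b) then complex_of_real (1 / sqrt 2) else 0)"
proof -
  \<comment> \<open>Types are nonempty, so the two basis vectors are distinct and their amplitudes
    never add up.\<close>
  have "(\<lambda>_::'q. False) \<noteq> (\<lambda>_. True)" by (metis (full_types))
  then show ?thesis
    by (auto simp: ghz_def tensor_state_ket0 tensor_state_ket1 axis_def ex_bool_eq
        complex_eq_iff)
qed

lemma sum_supported_on_const:
  fixes f :: "('q::finite \<Rightarrow> bool) \<Rightarrow> 'b::comm_monoid_add"
  assumes supp: "\<And>x. f x \<noteq> 0 \<Longrightarrow> \<exists>b. x = (\<lambda>_. b)"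
  shows "(\<Sum>x\<in>UNIV. f x) = f (\<lambda>_. False) + f (\<lambda>_. True)"
proof -
  have ne: "(\<lambda>_::'q. False) \<noteq> (\<lambda>_. True)" by (metis (full_types))
  have "(\<Sum>x\<in>UNIV. f x) = (\<Sum>x\<in>{\<lambda>_. False, \<lambda>_. True}. f x)"
  proof (rule sum.mono_neutral_right)
    show "\<forall>x\<in>UNIV - {\<lambda>_. False, \<lambda>_. True}. f x = 0"
      using supp by (metis (full_types) DiffD2 insertCI)
  qed auto
  then show ?thesis using ne by simp
qed

text \<open>Asking only for nonzero amplitudes at the constant strings makes this apply both to
  \<open>ghz\<close> and to every maximizer when \<open>k < N\<close>.\<close>

lemma ghz_like_genuinely_multipartite_entangled:
  fixes \<psi> :: "'q::finite state"
  assumes supp: "\<And>x. \<psi> $ x \<noteq> 0 \<Longrightarrow> \<exists>b. x = (\<lambda>_. b)" and nz: "\<And>b. \<psi> $ (\<lambda>_. b) \<noteq> 0"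
  shows "genuinely_multipartite_entangled \<psi>"
  unfolding genuinely_multipartite_entangled_def
proof (intro allI impI notI)
  fix S :: "'q set"
  assume "S \<noteq> {} \<and> S \<noteq> UNIV"
  then obtain a c where a: "a \<in> S" and c: "c \<notin> S" by auto
  let ?\<rho> = "reduced_density S (density_op \<psi>)"
  let ?x = "\<lambda>b. \<lambda>i\<in>S. b"
  assume "pure_density S ?\<rho>"
  then obtain \<phi> where \<phi>: "\<And>x y. x \<in> labels S \<Longrightarrow> y \<in> labels S \<Longrightarrow> ?\<rho> x y = \<phi> x * cnj (\<phi> y)"
    by (auto simp: pure_density_def)
  have lab: "?x b \<in> labels S" for b by (auto simp: labels_def)
  have diag: "?\<rho> (?x b) (?x b) \<noteq> 0" for b
  proof -
    \<comment> \<open>\<open>?z\<close> completes \<open>?x b\<close> to a constant string, which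
      contributes a strictly positive term.\<close>
    let ?z = "\<lambda>i\<in>-S. b"
    let ?f = "\<lambda>z. (cmod (\<psi> $ override_on z (?x b) S))\<^sup>2"
    have "?\<rho> (?x b) (?x b) = complex_of_real (\<Sum>z\<in>labels (- S). ?f z)"
      unfolding reduced_density_def density_op_def of_real_sum vec_lambda_beta
        complex_norm_square ..
    moreover have "override_on ?z (?x b) S = (\<lambda>_. b)" by (auto simp: override_on_def)
    then have "?f ?z > 0" using nz by simp
    then have "(\<Sum>z\<in>labels (- S). ?f z) > 0"
      by (intro sum_pos2[where i = ?z]) (auto simp: labels_def)
    ultimately show ?thesis by (metis of_real_eq_0_iff less_irrefl)
  qed
  have "?\<rho> (?x False) (?x True) = 0"
    unfolding reduced_density_def
  proof (rule sum.neutral, rule ballI, rule ccontr)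
    fix z
    assume "density_op \<psi> $ override_on z (?x False) S $ override_on z (?x True) S \<noteq> 0"
    \<comment> \<open>Both completions would be constant, with values False and True as read off at
      \<open>a\<close>, while \<open>z\<close> gives them the same value at
      \<open>c\<close>.\<close>
    then obtain b b' where "override_on z (?x False) S = (\<lambda>_. b)" "override_on z (?x True) S = (\<lambda>_. b')"
      by (force simp: density_op_def dest: supp)
    from fun_cong[OF this(1), of a] fun_cong[OF this(1), of c]
      fun_cong[OF this(2), of a] fun_cong[OF this(2), of c]
    show False using a c by simp
  qed
  \<comment> \<open>A vanishing product makes \<open>\<phi>\<close> zero at one of the two labels,
    and with it the diagonal entry there.\<close>
  with \<phi>[OF lab lab] diag show False by (metis mult_eq_0_iff complex_cnj_zero_iff)
qed

text \<open>The two eigenvectors attain the bounds on the spectrum. Entanglement of all maximizers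
  is claimed for \<open>k < N\<close> or \<open>N = 1\<close>: if \<open>k = N\<close> and
  \<open>N \<ge> 2\<close>, every entry is 1 or -1 and a product vector is also optimal.
  \<open>ghz\<close> is entangled in every case.\<close>

theorem mainTheorem3:
  fixes k N :: nat and h :: "'q::{finite, linorder} state_op" and F :: "'q state \<Rightarrow> real"
  defines "N \<equiv> CARD('q)" and "h \<equiv> h_op k" and "F \<equiv> qfi (h_op k)"
  assumes "k \<ge> 1" and "odd k" and "N \<ge> k"
  shows "eigenvector h (tensor_state (\<lambda>_. ket0)) (of_nat (N choose k))
    \<and> eigenvector h (tensor_state (\<lambda>_. ket1)) (- of_nat (N choose k))
    \<and> (\<forall>\<mu>. eigenvalue h \<mu> \<longrightarrow>
          \<mu> \<in> \<real> \<and> - real (N choose k) \<le> Re \<mu> \<and> Re \<mu> \<le> real (N choose k))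
    \<and> is_arg_max F (\<lambda>\<psi>. norm \<psi> = 1) ghz
    \<and> F ghz = 4 * (real (N choose k))\<^sup>2
    \<and> genuinely_multipartite_entangled (ghz :: 'q state)
    \<and> (k < N \<or> N = 1 \<longrightarrow>
        (\<forall>\<psi>. is_arg_max F (\<lambda>\<psi>. norm \<psi> = 1) \<psi> \<longrightarrow> genuinely_multipartite_entangled \<psi>))"
proof -
  let ?C = "real (N choose k)"
  have h: "h = diag_op (h_entry k)" and F: "F = qfi (diag_op (h_entry k))"
    by (simp_all add: h_def F_def h_op_eq_diag_op)
  have bound: "\<bar>h_entry k (x :: 'q \<Rightarrow> bool)\<bar> \<le> ?C" for x
    unfolding N_def by (rule h_entry_le)
  have h0: "h_entry k (\<lambda>_::'q. False) = ?C" and h1: "h_entry k (\<lambda>_::'q. True) = - ?C"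
    using \<open>odd k\<close> by (simp_all add: h_entry_const N_def spin_def)
  have ev0: "eigenvector h (tensor_state (\<lambda>_. ket0)) (of_nat (N choose k))"
    using eigenvector_diag_op_axis[of "h_entry k" "\<lambda>_::'q. False"]
    by (simp add: h tensor_state_ket0 h0)
  have ev1: "eigenvector h (tensor_state (\<lambda>_. ket1)) (- of_nat (N choose k))"
    using eigenvector_diag_op_axis[of "h_entry k" "\<lambda>_::'q. True"]
    by (simp add: h tensor_state_ket1 h1)
  have ev: "\<mu> \<in> \<real> \<and> - ?C \<le> Re \<mu> \<and> Re \<mu> \<le> ?C" if \<mu>: "eigenvalue h \<mu>" for \<mu>
  proof -
    obtain x :: "'q \<Rightarrow> bool" where "\<mu> = complex_of_real (h_entry k x)"
      using \<mu> unfolding h by (rule eigenvalue_diag_op)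
    then show ?thesis using bound[of x] by (auto simp: abs_le_iff)
  qed
  have le: "F \<psi> \<le> 4 * ?C\<^sup>2" if "norm \<psi> = 1" for \<psi>
    unfolding F using that bound by (rule qfi_diag_op_le)
  have ghz_supp: "\<exists>b. x = (\<lambda>_. b)" if "(ghz :: 'q state) $ x \<noteq> 0" for x
    using that unfolding ghz_nth by (rule contrapos_np) (rule if_not_P)
  have ghz_const: "(cmod ((ghz :: 'q state) $ (\<lambda>_. b)))\<^sup>2 = 1 / 2" for b
    by (auto simp: ghz_nth norm_divide power_divide)
  have ghz_sum: "(\<Sum>x\<in>UNIV. (cmod ((ghz :: 'q state) $ x))\<^sup>2 * f x)
      = (f (\<lambda>_. False) + f (\<lambda>_. True)) / 2" for f
    by (subst sum_supported_on_const) (use ghz_supp in \<open>auto simp: ghz_const\<close>)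
  have ghz_norm: "norm (ghz :: 'q state) = 1"
    using ghz_sum[of "\<lambda>_. 1"] by (simp add: norm_1_iff_sum_cmod_squares)
  \<comment> \<open>Equal weights on opposite entries give mean 0 and second moment
    \<open>?C\<^sup>2\<close>.\<close>
  have Fghz: "F ghz = 4 * ?C\<^sup>2"
    by (simp add: F qfi_diag_op ghz_sum h0 h1)
  have ghz_max: "is_arg_max F (\<lambda>\<psi>. norm \<psi> = 1) ghz"
    using le ghz_norm by (auto simp: is_arg_max_def Fghz not_less)
  have ghz_gme: "genuinely_multipartite_entangled (ghz :: 'q state)"
  proof (rule ghz_like_genuinely_multipartite_entangled)
    show "(ghz :: 'q state) $ (\<lambda>_. b) \<noteq> 0" for b using ghz_const[of b] by auto
  qed (rule ghz_supp)
  have gme: "genuinely_multipartite_entangled \<psi>"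
    if N: "k < N \<or> N = 1" and "is_arg_max F (\<lambda>\<psi>. norm \<psi> = 1) \<psi>" for \<psi>
  proof (cases "N = 1")
    case True
    \<comment> \<open>A single party admits no bipartition, so the condition is vacuous.\<close>
    then obtain a where "(UNIV :: 'q set) = {a}" by (auto simp: N_def card_1_singleton_iff)
    then have "S = {} \<or> S = UNIV" for S :: "'q set" by (metis subset_UNIV subset_singletonD)
    then show ?thesis unfolding genuinely_multipartite_entangled_def by blast
  next
    case False
    with N have "k < CARD('q)" by (simp add: N_def)
    \<comment> \<open>A maximizer does at least as well as \<open>ghz\<close>, which already reaches
      the upper bound.\<close>
    have norm: "norm \<psi> = 1" and "F \<psi> \<ge> F ghz"
      using that(2) ghz_norm by (auto simp: is_arg_max_def not_less)
    with le[OF norm] have max: "qfi (diag_op (h_entry k)) \<psi> = 4 * ?C\<^sup>2"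
      by (simp add: Fghz F[symmetric])
    have supp: "\<exists>b. x = (\<lambda>_. b)" if "\<psi> $ x \<noteq> 0" for x
    proof -
      have "\<bar>h_entry k x\<bar> = ?C"
        using norm bound max that by (rule qfi_diag_op_max_support)
      then have "x a = x b" for a b
        using h_entry_extremal_imp_const[OF \<open>k \<ge> 1\<close> \<open>k < CARD('q)\<close>] by (simp add: N_def)
      then show ?thesis by auto
    qed
    let ?p = "\<lambda>b. (cmod (\<psi> $ (\<lambda>_. b)))\<^sup>2"
    have sum: "(\<Sum>x\<in>UNIV. (cmod (\<psi> $ x))\<^sup>2 * f x)
        = ?p False * f (\<lambda>_. False) + ?p True * f (\<lambda>_. True)" for f
      by (rule sum_supported_on_const) (use supp in auto)
    have "?p False + ?p True = 1"
      using sum[of "\<lambda>_. 1"] norm by (simp add: norm_1_iff_sum_cmod_squares)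
    moreover have "?p False * ?C = ?p True * ?C"
      using qfi_diag_op_max_mean[OF norm bound max] by (simp add: sum h0 h1)
    \<comment> \<open>Mean zero balances the two weights, since \<open>N \<ge> k\<close> makes the
      binomial coefficient nonzero.\<close>
    then have "?p False = ?p True"
      using \<open>N \<ge> k\<close> by (simp add: binomial_eq_0_iff)
    ultimately have half: "?p b = 1 / 2" for b by (cases b) auto
    show ?thesis
    proof (rule ghz_like_genuinely_multipartite_entangled)
      show "\<psi> $ (\<lambda>_. b) \<noteq> 0" for b using half[of b] by auto
    qed (rule supp)
  qed
  show ?thesis
    by (intro conjI allI impI ev0 ev1 ghz_max Fghz ghz_gme gme) (use ev in blast)+
qed

end
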